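(* Let $\alpha\in\mathbb{R}$, $\alpha\neq 0$, and let $\Sigma\subset\mathbb{R}^3$ be a $K^\alpha$-translator with speed $\vec{v}$, where $\Sigma$ is not a plane. If $\Sigma$ is a surface of revolution, then the rotation axis of $\Sigma$ is parallel to the speed vector $\vec{v}$.
   Context: Let $\alpha\in\mathbb{R}$, $\alpha\ne 0$, and let $\vec{v}\in\mathbb{R}^3$ be a unit vector. A smooth surface $\Sigma$ in Euclidean space $\mathbb{R}^3$ with unit normal $N$ and Gauss curvature $K$ is called a $K^\alpha$-translator with speed $\vec{v}$ if $K^\alpha=\langle N,\vec{v}\rangle$ on $\Sigma$. The surface is not required to have $K>0$; it is implicitly assumed that $K^\alpha$ makes sense (for example, $K$ may be negative if $\alpha\in\mathbb{Z}$). Planes are discarded throughout. A surface of revolution is a surface invariant under all rotations about a straight line (the rotation axis), generated by rotating a planar curve contained in a plane through the axis.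
   Formalization: "Not a plane" is read as "not contained in a plane": for α > 0 a flat annulus in a plane parallel to the speed vector is a translator and a surface of revolution, but its axis is orthogonal to the speed vector. *)

theory Defs
  imports "HOL-Analysis.Analysis"
begin

primrec differentiable_upto ::
    "nat \<Rightarrow> 'a::real_normed_vector set \<Rightarrow> ('a \<Rightarrow> 'b::real_normed_vector) \<Rightarrow> bool" where
  "differentiable_upto 0 U f \<longleftrightarrow> continuous_on U f"
| "differentiable_upto (Suc n) U f \<longleftrightarrow>
     (\<forall>x\<in>U. f differentiable (at x)) \<and>
     (\<forall>h. differentiable_upto n U (\<lambda>x. frechet_derivative f (at x) h))"

definition smooth_map_on ::
    "'a::real_normed_vector set \<Rightarrow> ('a \<Rightarrow> 'b::real_normed_vector) \<Rightarrow> bool" where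
  "smooth_map_on U f \<longleftrightarrow> (\<forall>n. differentiable_upto n U f)"

definition local_parametrization ::
    "(real^3) set \<Rightarrow> (real^2) set \<Rightarrow> (real^2 \<Rightarrow> real^3) \<Rightarrow> bool" where
  "local_parametrization S U X \<longleftrightarrow>
     open U \<and> smooth_map_on U X \<and>
     (\<forall>q\<in>U. inj (frechet_derivative X (at q))) \<and>
     (\<exists>V Y. open V \<and> homeomorphism U (S \<inter> V) X Y)"

definition regular_surface :: "(real^3) set \<Rightarrow> bool" where
  "regular_surface S \<longleftrightarrow> (\<forall>p\<in>S. \<exists>U X. local_parametrization S U X \<and> p \<in> X ` U)"

definition tangent_plane :: "(real^3) set \<Rightarrow> real^3 \<Rightarrow> (real^3) set" where
  "tangent_plane S p =
     {w. \<exists>U X q h. local_parametrization S U X \<and> q \<in> U \<and> X q = p \<and>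
                   w = frechet_derivative X (at q) h}"

text \<open>On a regular surface a continuous unit normal field is automatically smooth.\<close>

definition unit_normal_field :: "(real^3) set \<Rightarrow> (real^3 \<Rightarrow> real^3) \<Rightarrow> bool" where
  "unit_normal_field S N \<longleftrightarrow>
     continuous_on S N \<and> (\<forall>p\<in>S. norm (N p) = 1 \<and> (\<forall>w\<in>tangent_plane S p. N p \<bullet> w = 0))"

definition partial :: "2 \<Rightarrow> (real^2 \<Rightarrow> real^3) \<Rightarrow> real^2 \<Rightarrow> real^3" where
  "partial i X q = frechet_derivative X (at q) (axis i 1)"

definition first_form :: "(real^2 \<Rightarrow> real^3) \<Rightarrow> real^2 \<Rightarrow> 2 \<Rightarrow> 2 \<Rightarrow> real" where
  "first_form X q i j = partial i X q \<bullet> partial j X q"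

definition second_form :: "(real^2 \<Rightarrow> real^3) \<Rightarrow> real^2 \<Rightarrow> 2 \<Rightarrow> 2 \<Rightarrow> real" where
  "second_form X q i j =
     sgn (cross3 (partial 1 X q) (partial 2 X q)) \<bullet> partial i (partial j X) q"

text \<open>The classical quotient of the determinants of the second and first fundamental forms.
  It does not depend on the parametrization, and is unchanged when the normal is reversed,
  so the definite description below is well defined at every point of a regular surface.\<close>

definition param_curvature :: "(real^2 \<Rightarrow> real^3) \<Rightarrow> real^2 \<Rightarrow> real" where
  "param_curvature X q =
     (second_form X q 1 1 * second_form X q 2 2 - (second_form X q 1 2)\<^sup>2) /
     (first_form X q 1 1 * first_form X q 2 2 - (first_form X q 1 2)\<^sup>2)"

definition gauss_curvature :: "(real^3) set \<Rightarrow> real^3 \<Rightarrow> real" where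
  "gauss_curvature S p =
     (THE k. \<exists>U X q. local_parametrization S U X \<and> q \<in> U \<and> X q = p \<and> k = param_curvature X q)"

text \<open>A power of a negative number makes sense when the exponent is an integer or, more
  generally, a quotient of an integer by an odd number; it is then an integer power of an odd
  root. A power of zero makes sense for positive exponents only.\<close>

definition power_defined :: "real \<Rightarrow> real \<Rightarrow> bool" where
  "power_defined x a \<longleftrightarrow>
     x > 0 \<or> (x = 0 \<and> a > 0) \<or>
     (x < 0 \<and> (\<exists>(m::int) (n::int). odd n \<and> a = of_int m / of_int n))"

definition real_power :: "real \<Rightarrow> real \<Rightarrow> real" where
  "real_power x a =
     (if x < 0 \<and> (\<exists>(m::int) (n::int). odd m \<and> odd n \<and> a = of_int m / of_int n)
      then - (\<bar>x\<bar> powr a) else \<bar>x\<bar> powr a)"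

lemma real_power_of_int:
  assumes "x \<noteq> 0"
  shows "real_power x (of_int k) = x powi k"
proof -
  have parity: "(\<exists>(m::int) (n::int). odd m \<and> odd n \<and> (of_int k :: real) = of_int m / of_int n)
                \<longleftrightarrow> odd k" (is "?L \<longleftrightarrow> _")
  proof
    assume ?L
    then obtain m n :: int where m: "odd m" and n: "odd n"
      and eq: "(of_int k :: real) = of_int m / of_int n"
      by blast
    from n have "n \<noteq> 0" by (metis even_zero)
    then have "(of_int k :: real) * of_int n = of_int m"
      unfolding eq by simp
    then have "k * n = m"
      by (metis of_int_eq_iff of_int_mult)
    with m show "odd k"
      by (metis dvd_mult2)
  next
    assume k: "odd k"
    have "(of_int k :: real) = of_int k / of_int 1"
      by simp
    with k show ?L
      by (metis odd_one)
  qed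
  have pow: "\<bar>x\<bar> powr of_int k = \<bar>x\<bar> powi k"
    by (rule powr_real_of_int') (use assms in auto)
  show ?thesis
  proof (cases "x < 0")
    case True
    then have "x powi k = (- \<bar>x\<bar>) powi k"
      by simp
    also have "\<dots> = (if even k then \<bar>x\<bar> powi k else - (\<bar>x\<bar> powi k))"
      by (rule power_int_minus_left)
    finally show ?thesis
      using True unfolding real_power_def parity pow by (simp only: if_split) argo
  next
    case False
    then show ?thesis
      unfolding real_power_def parity pow by simp
  qed
qed

definition K_translator ::
    "real \<Rightarrow> real^3 \<Rightarrow> (real^3) set \<Rightarrow> (real^3 \<Rightarrow> real^3) \<Rightarrow> bool" where
  "K_translator \<alpha> v S N \<longleftrightarrow>
     regular_surface S \<and> unit_normal_field S N \<and>
     (\<forall>p\<in>S. power_defined (gauss_curvature S p) \<alpha> \<and>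
            real_power (gauss_curvature S p) \<alpha> = N p \<bullet> v)"

text \<open>A rotation matrix that fixes \<open>u \<noteq> 0\<close> is a rotation about the line spanned by \<open>u\<close>; the axis
  here is the line through \<open>a\<close> with direction \<open>u\<close>.\<close>

definition rotations_about :: "real^3 \<Rightarrow> real^3 \<Rightarrow> (real^3 \<Rightarrow> real^3) set" where
  "rotations_about a u =
     {\<lambda>x. a + Q *v (x - a) |Q. rotation_matrix Q \<and> Q *v u = u}"

text \<open>Here \<open>{x. w \<bullet> (x - a) = 0}\<close> is a plane containing the axis, and \<open>\<gamma> ` I\<close> is the generating
  curve. Regularity of \<open>\<gamma>\<close> is not demanded: the profile of a regular surface is regular anyway.\<close>

definition surface_of_revolution :: "(real^3) set \<Rightarrow> real^3 \<Rightarrow> real^3 \<Rightarrow> bool" where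
  "surface_of_revolution S a u \<longleftrightarrow>
     u \<noteq> 0 \<and>
     (\<forall>R\<in>rotations_about a u. R ` S = S) \<and>
     (\<exists>w (\<gamma> :: real \<Rightarrow> real^3) I.
        w \<noteq> 0 \<and> w \<bullet> u = 0 \<and> is_interval I \<and> continuous_on I \<gamma> \<and>
        \<gamma> ` I \<subseteq> {x. w \<bullet> (x - a) = 0} \<and>
        S = (\<Union>R\<in>rotations_about a u. R ` \<gamma> ` I))"

text \<open>Discarding planes has to discard pieces of planes as well: for positive exponents a flat
  annulus whose plane is parallel to \<open>v\<close> is a translator, but its axis is orthogonal to \<open>v\<close>.\<close>

definition planar :: "(real^3) set \<Rightarrow> bool" where
  "planar S \<longleftrightarrow> (\<exists>n c. n \<noteq> 0 \<and> S \<subseteq> {x. n \<bullet> x = c})"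

end

theory Submission
  imports Defs
begin

text \<open>The speed condition is a scalar condition, and the Gauss curvature is the same at \<open>p\<close> and at
  its rotated copies \<open>R p\<close>. Hence \<open>N (R p) \<bullet> v = N p \<bullet> v\<close> for every rotation \<open>R\<close> about the axis.
  The tangent plane at \<open>R p\<close> is the rotated tangent plane at \<open>p\<close>, so \<open>N (R p)\<close> is the rotated
  normal \<open>Q (N p)\<close> up to sign, where \<open>Q\<close> is the linear part of \<open>R\<close>. Therefore
  \<open>(Q (N p) \<bullet> v)\<^sup>2\<close>, in which the sign is lost, does not depend on \<open>Q\<close>. As \<open>Q\<close> turns,
  \<open>Q (N p) \<bullet> v\<close> is a constant plus a sinusoid whose amplitude is the product of the lengths of the
  components of \<open>N p\<close> and \<open>v\<close> orthogonal to the axis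
  (\<open>unit_vector_on_axis_if_rotation_invariant\<close>). So the amplitude vanishes: either \<open>v\<close> is parallel
  to the axis, which is the claim, or \<open>N p\<close> is parallel to the axis at every point. In the second
  case the height along the axis has zero derivative on the connected surface, which then lies in a
  plane orthogonal to the axis (\<open>planar_if_tangent_planes_orthogonal\<close>).

  The invariance of the Gauss curvature and the equivariance of the tangent planes both come from
  transporting parametrizations by rigid motions (\<open>local_parametrization_rigid_motion\<close>).\<close>

section \<open>Derivatives under affine maps\<close>

lemma differentiable_upto_cong:
  assumes "open U" "\<And>x. x \<in> U \<Longrightarrow> f x = g x" "differentiable_upto n U f"
  shows "differentiable_upto n U g"
  using assms(2,3)
proof (induction n arbitrary: f g)
  case 0
  then show ?case
    by (simp cong: continuous_on_cong)
next
  case (Suc n)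
  have diff: "f differentiable (at x)" if "x \<in> U" for x
    using Suc.prems(2) that by simp
  have eq: "frechet_derivative f (at x) = frechet_derivative g (at x)" if "x \<in> U" for x
    using frechet_derivative_transform_within_open[OF diff[OF that] \<open>open U\<close> that] Suc.prems(1)
    by blast
  have "g differentiable (at x)" if "x \<in> U" for x
    using diff[OF that] Suc.prems(1) that \<open>open U\<close>
    unfolding differentiable_def by (meson has_derivative_transform_within_open)
  moreover have "differentiable_upto n U (\<lambda>x. frechet_derivative g (at x) h)" for h
    using Suc.IH[of "\<lambda>x. frechet_derivative f (at x) h"] Suc.prems(2) eq by simp
  ultimately show ?case
    by simp
qed

lemma has_derivative_affine:
  assumes "bounded_linear L" "f differentiable (at x)"
  shows "((\<lambda>x. b + L (f x)) has_derivative (\<lambda>h. L (frechet_derivative f (at x) h))) (at x)"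
proof -
  have "(f has_derivative frechet_derivative f (at x)) (at x)"
    using assms(2) frechet_derivative_works by blast
  then have "((\<lambda>x. L (f x)) has_derivative (\<lambda>h. L (frechet_derivative f (at x) h))) (at x)"
    by (rule bounded_linear.has_derivative[OF assms(1)])
  then show ?thesis
    by (auto intro!: derivative_eq_intros)
qed

lemma frechet_derivative_affine:
  assumes "bounded_linear L" "f differentiable (at x)"
  shows "frechet_derivative (\<lambda>x. b + L (f x)) (at x) = (\<lambda>h. L (frechet_derivative f (at x) h))"
  using frechet_derivative_at[OF has_derivative_affine[OF assms]] by simp

lemma differentiable_upto_affine:
  assumes "bounded_linear L" "open U" "differentiable_upto n U f"
  shows "differentiable_upto n U (\<lambda>x. b + L (f x))"
  using assms(3)
proof (induction n arbitrary: f b)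
  case 0
  then show ?case
    using bounded_linear.continuous_on[OF assms(1)] by (auto intro!: continuous_intros)
next
  case (Suc n)
  have diff: "f differentiable (at x)" if "x \<in> U" for x
    using Suc.prems that by simp
  have "differentiable_upto n U (\<lambda>x. frechet_derivative (\<lambda>x. b + L (f x)) (at x) h)" for h
  proof (rule differentiable_upto_cong[OF \<open>open U\<close>])
    show "differentiable_upto n U (\<lambda>x. 0 + L (frechet_derivative f (at x) h))"
      using Suc.IH[where b = 0] Suc.prems by simp
  qed (simp add: frechet_derivative_affine[OF assms(1) diff])
  moreover have "(\<lambda>x. b + L (f x)) differentiable (at x)" if "x \<in> U" for x
    using has_derivative_affine[OF assms(1) diff[OF that]] unfolding differentiable_def by blast
  ultimately show ?case
    by simp
qed

lemma smooth_map_on_affine: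
  "bounded_linear L \<Longrightarrow> open U \<Longrightarrow> smooth_map_on U f \<Longrightarrow> smooth_map_on U (\<lambda>x. b + L (f x))"
  unfolding smooth_map_on_def using differentiable_upto_affine by blast

lemma smooth_map_on_differentiable:
  "smooth_map_on U X \<Longrightarrow> q \<in> U \<Longrightarrow> X differentiable (at q)"
  unfolding smooth_map_on_def using differentiable_upto.simps(2)[of 0 U X] by blast

lemma smooth_map_on_partial_differentiable:
  assumes "smooth_map_on U X" "q \<in> U"
  shows "partial j X differentiable (at q)"
proof -
  have "differentiable_upto (Suc (Suc 0)) U X"
    using assms(1) unfolding smooth_map_on_def by blast
  then show ?thesis
    using assms(2) unfolding differentiable_upto.simps partial_def[abs_def] by blast
qed

section \<open>Rigid motions act on surfaces\<close>

lemma rotation_matrix_inner: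
  fixes Q :: "real^3^3"
  assumes "rotation_matrix Q"
  shows "(Q *v x) \<bullet> (Q *v y) = x \<bullet> y"
proof -
  have "orthogonal_transformation ((*v) Q)"
    using assms by (simp add: rotation_matrix_def orthogonal_transformation_matrix)
  then show ?thesis
    by (simp add: orthogonal_transformation_def)
qed

lemma rotation_matrix_transpose:
  "rotation_matrix Q \<Longrightarrow> rotation_matrix (transpose Q)"
  by (simp add: rotation_matrix_def det_transpose)

lemma rotation_matrix_transpose_cancel:
  fixes Q :: "real^3^3"
  assumes "rotation_matrix Q"
  shows "transpose Q *v (Q *v x) = x" "Q *v (transpose Q *v x) = x"
  using assms
  by (simp_all add: rotation_matrix_def orthogonal_matrix_def matrix_vector_mul_assoc
      del: transpose_matrix_vector)

lemma sgn_rotation_matrix: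
  fixes Q :: "real^3^3"
  assumes "rotation_matrix Q"
  shows "sgn (Q *v x) = Q *v sgn x"
  using rotation_matrix_inner[OF assms, of x x]
  by (simp add: sgn_div_norm norm_eq_sqrt_inner matrix_vector_mult_scaleR)

text \<open>The inverse chart is composed with the inverse motion \<open>k\<close>, so the open set that cuts the patch
  out of the surface becomes its preimage under \<open>k\<close>.\<close>

lemma local_parametrization_rigid_motion:
  assumes Q: "rotation_matrix Q" and X: "local_parametrization S U X"
  shows "local_parametrization ((\<lambda>x. b + Q *v x) ` S) U (\<lambda>q. b + Q *v X q)"
proof -
  define g where "g = (\<lambda>x. b + Q *v x)"
  define k where "k = (\<lambda>y. transpose Q *v (y - b))"
  note cancel = rotation_matrix_transpose_cancel[OF Q]
  have kg: "k (g x) = x" and gk: "g (k x) = x" for x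
    by (simp_all add: g_def k_def cancel del: transpose_matrix_vector)
  have contg: "continuous_on A g" and contk: "continuous_on A k" for A
    unfolding g_def k_def
    by (auto intro!: continuous_intros bounded_linear.continuous_on[OF matrix_vector_mul_bounded_linear]
        simp del: transpose_matrix_vector)
  obtain V Y where U: "open U" and sm: "smooth_map_on U X"
    and inj: "\<And>q. q \<in> U \<Longrightarrow> inj (frechet_derivative X (at q))"
    and V: "open V" and hom: "homeomorphism U (S \<inter> V) X Y"
    using X unfolding local_parametrization_def by blast
  have img: "g ` (S \<inter> V) = g ` S \<inter> k -` V"
    using kg gk by force
  have "homeomorphism (S \<inter> V) (g ` (S \<inter> V)) g k"
    unfolding homeomorphism_def using contg contk kg gk by (auto simp: image_iff)
  from homeomorphism_compose[OF hom this]
  have "homeomorphism U (g ` S \<inter> k -` V) (g \<circ> X) (Y \<circ> k)"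
    unfolding img .
  moreover have "open (k -` V)"
    using open_vimage[OF V] contk by blast
  moreover have "inj (frechet_derivative (\<lambda>q. b + Q *v X q) (at q))" if "q \<in> U" for q
  proof -
    have "inj ((*v) Q)"
      using cancel(1) by (metis injI)
    then show ?thesis
      using inj[OF that] frechet_derivative_affine[OF matrix_vector_mul_bounded_linear
          smooth_map_on_differentiable[OF sm that], of b Q]
      by (simp add: inj_def)
  qed
  ultimately show ?thesis
    unfolding local_parametrization_def
    using U smooth_map_on_affine[OF matrix_vector_mul_bounded_linear U sm]
    by (auto simp: g_def o_def)
qed

text \<open>First order derivatives rotate with \<open>Q\<close>, hence so do the second order ones and the unit
  normal: a proper rotation commutes with the cross product. All coefficients of both fundamental
  forms are inner products of such vectors, and therefore do not change.\<close>

lemma param_curvature_rigid_motion: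
  assumes Q: "rotation_matrix Q" and U: "open U" and sm: "smooth_map_on U X" and q: "q \<in> U"
  shows "param_curvature (\<lambda>q. b + Q *v X q) q = param_curvature X q"
proof -
  let ?Z = "\<lambda>q. b + Q *v X q"
  note lin = matrix_vector_mul_bounded_linear[of Q]
  have first: "partial j ?Z q' = Q *v partial j X q'" if "q' \<in> U" for j q'
    unfolding partial_def
    using frechet_derivative_affine[OF lin smooth_map_on_differentiable[OF sm that]] by simp
  have second: "partial i (partial j ?Z) q = Q *v partial i (partial j X) q" for i j
  proof -
    note diff = smooth_map_on_partial_differentiable[OF sm q, of j]
    have "(\<lambda>q. 0 + Q *v partial j X q) differentiable (at q)"
      using has_derivative_affine[OF lin diff] unfolding differentiable_def by blast
    then have "frechet_derivative (\<lambda>q. 0 + Q *v partial j X q) (at q)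
        = frechet_derivative (partial j ?Z) (at q)"
      by (rule frechet_derivative_transform_within_open[OF _ U q]) (simp add: first)
    then show ?thesis
      unfolding partial_def[of i] frechet_derivative_affine[OF lin diff] by metis
  qed
  have "first_form ?Z q i j = first_form X q i j" for i j
    by (simp add: first_form_def first[OF q] rotation_matrix_inner[OF Q])
  moreover have "second_form ?Z q i j = second_form X q i j" for i j
    by (simp add: second_form_def first[OF q] second cross_rotation_matrix[OF Q]
        sgn_rotation_matrix[OF Q] rotation_matrix_inner[OF Q])
  ultimately show ?thesis
    by (simp add: param_curvature_def)
qed

text \<open>For a motion that maps the surface to itself the two definite descriptions, at \<open>p\<close> and at its
  image, range over the same set of values: parametrizations are transported forward by the motion
  and back by its inverse.\<close>

lemma gauss_curvature_rigid_motion: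
  assumes Q: "rotation_matrix Q" and S: "(\<lambda>x. b + Q *v x) ` S = S"
  shows "gauss_curvature S (b + Q *v p) = gauss_curvature S p"
proof -
  define attained where "attained = (\<lambda>p k. \<exists>U X q. local_parametrization S U X \<and> q \<in> U \<and>
    X q = p \<and> k = param_curvature X q)"
  have transport: "attained (b + Q *v p) k"
    if "rotation_matrix Q" "(\<lambda>x. b + Q *v x) ` S = S" "attained p k" for Q b p k
  proof -
    from that(3) obtain U X q where X: "local_parametrization S U X" and q: "q \<in> U" "X q = p"
      and k: "k = param_curvature X q"
      unfolding attained_def by blast
    have "local_parametrization S U (\<lambda>q. b + Q *v X q)"
      using local_parametrization_rigid_motion[OF that(1) X, of b] that(2) by simp
    moreover have "k = param_curvature (\<lambda>q. b + Q *v X q) q"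
      using param_curvature_rigid_motion[OF that(1) _ _ q(1)] X k
      unfolding local_parametrization_def by simp
    ultimately show ?thesis
      unfolding attained_def using q by blast
  qed
  let ?b' = "- (transpose Q *v b)"
  have inverse: "?b' + transpose Q *v (b + Q *v x) = x" for x
    by (simp add: matrix_vector_right_distrib rotation_matrix_transpose_cancel[OF Q]
        del: transpose_matrix_vector)
  have "(\<lambda>x. ?b' + transpose Q *v x) ` S = (\<lambda>x. ?b' + transpose Q *v x) ` (\<lambda>x. b + Q *v x) ` S"
    using S by simp
  also have "\<dots> = S"
    by (simp only: image_image inverse image_ident)
  finally have "attained p k" if "attained (b + Q *v p) k" for k
    using transport[OF rotation_matrix_transpose[OF Q] _ that, of ?b'] by (simp only: inverse)
  then have "attained (b + Q *v p) = attained p"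
    using transport[OF Q S] by blast
  then show ?thesis
    unfolding gauss_curvature_def attained_def by metis
qed

text \<open>A plane in \<open>\<real>\<^sup>3\<close> determines its unit normal up to sign; the square makes the
  conclusion independent of that sign.\<close>

lemma inner_unit_normal_squared:
  fixes m n a b x :: "real^3"
  assumes "cross3 a b \<noteq> 0" "norm m = 1" "norm n = 1"
    and "m \<bullet> a = 0" "m \<bullet> b = 0" "n \<bullet> a = 0" "n \<bullet> b = 0"
  shows "(m \<bullet> x)\<^sup>2 = (n \<bullet> x)\<^sup>2"
proof -
  define w where "w = cross3 a b"
  have normal: "(l \<bullet> x)\<^sup>2 * (w \<bullet> w) = (w \<bullet> x)\<^sup>2" if l: "norm l = 1" "l \<bullet> a = 0" "l \<bullet> b = 0" for l
  proof -
    have "cross3 l w = 0"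
      unfolding w_def using that by (simp add: Lagrange)
    then have "collinear {0, l, w}"
      by (simp add: cross_eq_0)
    moreover have "l \<noteq> 0"
      using l(1) by auto
    ultimately obtain c where c: "w = c *\<^sub>R l"
      using assms(1) w_def by (auto simp: collinear_lemma)
    have "l \<bullet> l = 1"
      using l(1) by (simp add: dot_square_norm)
    then show ?thesis
      unfolding c by (simp add: power2_eq_square)
  qed
  have "w \<bullet> w \<noteq> 0"
    using assms(1) w_def by simp
  then show ?thesis
    using normal[of m] normal[of n] assms by (metis mult_right_cancel)
qed

text \<open>The normal at the image point and the rotated normal are both orthogonal to the image of the
  tangent plane, hence equal up to sign.\<close>

lemma unit_normal_rigid_motion:
  assumes Q: "rotation_matrix Q" and S: "(\<lambda>x. b + Q *v x) ` S = S"
    and reg: "regular_surface S" and N: "unit_normal_field S N" and p: "p \<in> S"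
  shows "(N (b + Q *v p) \<bullet> x)\<^sup>2 = ((Q *v N p) \<bullet> x)\<^sup>2"
proof -
  obtain U X q where X: "local_parametrization S U X" and q: "q \<in> U" "X q = p"
    using reg p unfolding regular_surface_def image_iff by metis
  define D where "D = frechet_derivative X (at q)"
  have diff: "X differentiable (at q)"
    using X q smooth_map_on_differentiable unfolding local_parametrization_def by blast
  have linD: "linear D"
    unfolding D_def by (rule linear_frechet_derivative[OF diff])
  have injD: "inj D"
    using X q unfolding local_parametrization_def D_def by blast
  have tangent: "D h \<in> tangent_plane S p" for h
    unfolding tangent_plane_def D_def using X q by blast
  have tangent': "Q *v D h \<in> tangent_plane S (b + Q *v p)" for h
  proof -
    have "local_parametrization S U (\<lambda>q. b + Q *v X q)"
      using local_parametrization_rigid_motion[OF Q X, of b] S by simp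
    moreover have "Q *v D h = frechet_derivative (\<lambda>q. b + Q *v X q) (at q) h"
      unfolding D_def
      using frechet_derivative_affine[OF matrix_vector_mul_bounded_linear diff] by metis
    ultimately show ?thesis
      unfolding tangent_plane_def using q by blast
  qed
  have p': "b + Q *v p \<in> S"
    using S p by blast
  have "cross3 (D (axis 1 1)) (D (axis 2 1)) \<noteq> 0"
  proof
    assume "cross3 (D (axis 1 1)) (D (axis 2 1)) = 0"
    then consider "D (axis 1 1) = 0" | "D (axis 2 1) = 0"
      | c where "D (axis 2 1) = c *\<^sub>R D (axis 1 1)"
      by (auto simp: cross_eq_0 collinear_lemma)
    then have "axis 1 1 = (0::real^2) \<or> axis 2 1 = (0::real^2) \<or>
        (\<exists>c. axis 2 1 = c *\<^sub>R (axis 1 1 :: real^2))"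
    proof cases
      case 1
      then show ?thesis
        using linear_injective_0[OF linD] injD by blast
    next
      case 2
      then show ?thesis
        using linear_injective_0[OF linD] injD by blast
    next
      case (3 c)
      then have "D (axis 2 1) = D (c *\<^sub>R axis 1 1)"
        by (simp add: linear_cmul[OF linD])
      then show ?thesis
        using inj_eq[OF injD] by blast
    qed
    moreover have "axis 2 1 \<noteq> c *\<^sub>R (axis 1 1 :: real^2)" for c
      by (simp add: vec_eq_iff axis_def forall_2)
    ultimately show False
      by (simp add: axis_eq_0_iff)
  qed
  then have "cross3 (Q *v D (axis 1 1)) (Q *v D (axis 2 1)) \<noteq> 0"
    using rotation_matrix_inner[OF Q] by (metis cross_rotation_matrix[OF Q] inner_eq_zero_iff)
  moreover have "norm (Q *v N p) = 1"
    using N p rotation_matrix_inner[OF Q, of "N p" "N p"]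
    unfolding unit_normal_field_def norm_eq_sqrt_inner by simp
  ultimately show ?thesis
    using N p p' tangent tangent'
    by (intro inner_unit_normal_squared[of "Q *v D (axis 1 1)" "Q *v D (axis 2 1)"])
      (auto simp: unit_normal_field_def rotation_matrix_inner[OF Q])
qed

section \<open>Rotating one vector against another\<close>

text \<open>Rodrigues' formula for the rotation about the unit vector \<open>e\<close> by the angle with cosine \<open>c\<close>
  and sine \<open>s\<close>.\<close>

definition rodrigues :: "real^3 \<Rightarrow> real \<Rightarrow> real \<Rightarrow> real^3 \<Rightarrow> real^3" where
  "rodrigues e c s x = c *\<^sub>R x + s *\<^sub>R cross3 e x + ((1 - c) * (e \<bullet> x)) *\<^sub>R e"

lemma rodrigues_axis: "norm e = 1 \<Longrightarrow> rodrigues e c s e = e"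
  by (simp add: rodrigues_def dot_square_norm flip: scaleR_add_left)

lemma linear_rodrigues: "linear (rodrigues e c s)"
  by (rule linearI)
    (simp_all add: rodrigues_def cross_add_right cross_mult_right inner_add_right algebra_simps
      flip: scaleR_add_left)

lemma rotation_matrix_rodrigues:
  assumes e: "norm e = 1" and cs: "c\<^sup>2 + s\<^sup>2 = 1"
  shows "rotation_matrix (matrix (rodrigues e c s))"
proof -
  have ee: "e$1 * e$1 + e$2 * e$2 + e$3 * e$3 = 1"
    using e by (simp add: norm_eq_1 inner_vec_def sum_3)
  have cs': "c * c + s * s = 1"
    using cs by (simp add: power2_eq_square)
  have "rodrigues e c s x \<bullet> rodrigues e c s x = x \<bullet> x" for x
    using ee cs' unfolding rodrigues_def
    apply (simp add: inner_vec_def sum_3 cross3_def vector_def)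
    by algebra
  then have "orthogonal_transformation (rodrigues e c s)"
    by (simp add: orthogonal_transformation linear_rodrigues norm_eq_sqrt_inner)
  then have "orthogonal_matrix (matrix (rodrigues e c s))"
    by (simp add: orthogonal_transformation_matrix)
  moreover have "det (matrix (rodrigues e c s)) = 1"
    using ee cs' unfolding rodrigues_def det_3 matrix_def
    apply (simp add: inner_vec_def sum_3 cross3_def vector_def axis_def)
    by algebra
  ultimately show ?thesis
    by (simp add: rotation_matrix_def)
qed

text \<open>Comparing the squares at the angles \<open>0\<close>, \<open>\<pi>\<close> and \<open>\<plusminus>\<pi>/2\<close> gives \<open>P\<^sup>2 = R\<^sup>2\<close>. This still admits
  \<open>P = \<plusminus>R \<noteq> 0\<close> with \<open>A = 0\<close>, which one further angle, with cosine \<open>3/5\<close> and sine \<open>4/5\<close>, excludes.\<close>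

lemma sinusoid_zero_if_square_constant:
  fixes A P R k :: real
  assumes "\<And>c s. c\<^sup>2 + s\<^sup>2 = 1 \<Longrightarrow> (A + c * P + s * R)\<^sup>2 = k"
  shows "P = 0 \<and> R = 0"
proof -
  have expand: "(A + c * P + s * R)\<^sup>2 =
      A*A + c\<^sup>2 * (P*P) + s\<^sup>2 * (R*R) + 2 * c * (A*P) + 2 * s * (A*R) + 2 * c * s * (P*R)" for c s
    by (simp add: power2_eq_square algebra_simps)
  have "A*A + P*P + 2 * (A*P) = k" "A*A + P*P + (-2) * (A*P) = k"
    "A*A + R*R + 2 * (A*R) = k" "A*A + R*R + (-2) * (A*R) = k"
    "A*A + 9/25 * (P*P) + 16/25 * (R*R) + 6/5 * (A*P) + 8/5 * (A*R) + 24/25 * (P*R) = k"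
    using assms[unfolded expand, of 1 0] assms[unfolded expand, of "-1" 0]
      assms[unfolded expand, of 0 1] assms[unfolded expand, of 0 "-1"]
      assms[unfolded expand, of "3/5" "4/5"]
    by (simp_all add: power_divide)
  then have "P * P = R * R" "P * R = 0"
    by linarith+
  then show ?thesis
    by auto
qed

text \<open>By Rodrigues' formula \<open>Q n \<bullet> v\<close> is \<open>A + c * P + s * R\<close> at the angle with cosine \<open>c\<close> and sine
  \<open>s\<close>, so the sinusoidal part has to vanish.\<close>

lemma unit_vector_on_axis_if_rotation_invariant:
  fixes n v u :: "real^3"
  assumes u: "u \<noteq> 0" and n: "norm n = 1" and v: "norm v = 1" and off: "cross3 u v \<noteq> 0"
    and const: "\<And>Q. rotation_matrix Q \<Longrightarrow> Q *v u = u \<Longrightarrow> ((Q *v n) \<bullet> v)\<^sup>2 = k"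
  shows "cross3 u n = 0"
proof -
  define e where "e = sgn u"
  have e: "norm e = 1" and ue: "u = norm u *\<^sub>R e"
    using u by (simp_all add: e_def norm_sgn sgn_div_norm)
  define A where "A = (e \<bullet> n) * (e \<bullet> v)"
  define P where "P = n \<bullet> v - A"
  define R where "R = cross3 e n \<bullet> v"
  have "(A + c * P + s * R)\<^sup>2 = k" if cs: "c\<^sup>2 + s\<^sup>2 = 1" for c s
  proof -
    have apply_rodrigues: "matrix (rodrigues e c s) *v x = rodrigues e c s x" for x
      by (simp add: matrix_works linear_matrix_vector_mul_eq linear_rodrigues)
    have "rodrigues e c s u = u"
      using rodrigues_axis[OF e] linear_cmul[OF linear_rodrigues] ue by metis
    then have "(rodrigues e c s n \<bullet> v)\<^sup>2 = k"
      using const[OF rotation_matrix_rodrigues[OF e cs]] by (simp add: apply_rodrigues)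
    moreover have "rodrigues e c s n \<bullet> v = A + c * P + s * R"
      by (simp add: rodrigues_def A_def P_def R_def inner_add_left algebra_simps)
    ultimately show ?thesis
      by simp
  qed
  then have PR: "P = 0 \<and> R = 0"
    by (rule sinusoid_zero_if_square_constant)
  \<comment> \<open>\<open>e \<times> n\<close> and \<open>e \<times> v\<close> lie in the plane orthogonal to \<open>e\<close>, with inner product \<open>P\<close> and signed
    area \<open>R\<close>; when both vanish, one of the two vectors is zero.\<close>
  have ee: "e \<bullet> e = 1"
    using e by (simp add: dot_square_norm)
  have "cross3 e n \<bullet> cross3 e v = P"
    by (simp add: dot_cross ee P_def A_def inner_commute)
  moreover have "cross3 (cross3 e n) (cross3 e v) = R *\<^sub>R e"
    by (simp add: cross_cross_det R_def cross_triple[of e n v] inner_commute[of _ e] dot_cross_self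
        flip: dot_cross_det)
  ultimately have "cross3 e n = 0 \<or> cross3 e v = 0"
    using PR norm_and_cross_eq_0[of "cross3 e n" "cross3 e v"] by simp
  then show ?thesis
    using off ue by (metis cross_mult_left scaleR_zero_right)
qed

section \<open>Surfaces with a constant normal direction\<close>

text \<open>The height \<open>u \<bullet> x\<close> is constant on the image of a small ball in the parameter domain, and such
  an image is relatively open because a parametrization is a homeomorphism onto an open part of the
  surface. Connectedness turns local into global constancy.\<close>

lemma planar_if_tangent_planes_orthogonal:
  assumes conn: "connected S" and reg: "regular_surface S" and u: "u \<noteq> 0"
    and orth: "\<And>p w. p \<in> S \<Longrightarrow> w \<in> tangent_plane S p \<Longrightarrow> u \<bullet> w = 0"
  shows "planar S"
proof -
  have "(\<lambda>x. u \<bullet> x) constant_on S"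
  proof (rule locally_constant_imp_constant[OF conn])
    fix p assume p: "p \<in> S"
    obtain U X q where X: "local_parametrization S U X" and q: "q \<in> U" "X q = p"
      using reg p unfolding regular_surface_def image_iff by metis
    obtain V Y where U: "open U" and sm: "smooth_map_on U X" and V: "open V"
      and hom: "homeomorphism U (S \<inter> V) X Y"
      using X unfolding local_parametrization_def by blast
    obtain r where r: "r > 0" "ball q r \<subseteq> U"
      using U q by (meson open_contains_ball)
    have deriv: "((\<lambda>x. u \<bullet> X x) has_derivative (\<lambda>h. 0)) (at x)" if "x \<in> ball q r" for x
    proof -
      have x: "x \<in> U"
        using that r by blast
      have "u \<bullet> frechet_derivative X (at x) h = 0" for h
      proof (rule orth)
        show "X x \<in> S"
          using hom x unfolding homeomorphism_def by blast
        show "frechet_derivative X (at x) h \<in> tangent_plane S (X x)"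
          unfolding tangent_plane_def using X x by blast
      qed
      then show ?thesis
        using has_derivative_affine[OF bounded_linear_inner_right
            smooth_map_on_differentiable[OF sm x], of 0 u]
        by simp
    qed
    have const: "u \<bullet> X x = u \<bullet> p" if "x \<in> ball q r" for x
      using has_derivative_zero_unique[OF convex_ball has_derivative_at_withinI[OF deriv] that, of q]
        r q by simp
    show "\<exists>T. openin (top_of_set S) T \<and> p \<in> T \<and> (\<forall>x\<in>T. u \<bullet> x = u \<bullet> p)"
    proof (intro exI conjI)
      have "openin (top_of_set (S \<inter> V)) (X ` ball q r)"
        using homeomorphism_imp_open_map[OF hom] r U by (meson open_ball open_subset)
      moreover have "openin (top_of_set S) (S \<inter> V)"
        using V by blast
      ultimately show "openin (top_of_set S) (X ` ball q r)"
        using openin_trans by blast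
    qed (use const q r in auto)
  qed
  then show ?thesis
    using u unfolding planar_def constant_on_def by blast
qed

section \<open>Rotational translators\<close>

theorem proposition2p1:
  fixes \<alpha> :: real and v a u :: "real^3" and \<Sigma> :: "(real^3) set" and N :: "real^3 \<Rightarrow> real^3"
  assumes "\<alpha> \<noteq> 0"
    and "norm v = 1"
    and "connected \<Sigma>"
    and "K_translator \<alpha> v \<Sigma> N"
    and "\<not> planar \<Sigma>"
    and "surface_of_revolution \<Sigma> a u"
  shows "\<exists>c. u = c *\<^sub>R v"
proof (rule ccontr)
  assume "\<nexists>c. u = c *\<^sub>R v"
  then have off: "cross3 u v \<noteq> 0"
    using \<open>norm v = 1\<close> by (auto simp: cross_eq_0 insert_commute[of u] collinear_lemma[of v])
  have reg: "regular_surface \<Sigma>" and N: "unit_normal_field \<Sigma> N"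
    and speed: "\<And>p. p \<in> \<Sigma> \<Longrightarrow> real_power (gauss_curvature \<Sigma> p) \<alpha> = N p \<bullet> v"
    using \<open>K_translator \<alpha> v \<Sigma> N\<close> unfolding K_translator_def by auto
  have u: "u \<noteq> 0" and inv: "\<And>R. R \<in> rotations_about a u \<Longrightarrow> R ` \<Sigma> = \<Sigma>"
    using \<open>surface_of_revolution \<Sigma> a u\<close> unfolding surface_of_revolution_def by auto
  have axial: "cross3 u (N p) = 0" if p: "p \<in> \<Sigma>" for p
  proof (rule unit_vector_on_axis_if_rotation_invariant[OF u _ \<open>norm v = 1\<close> off])
    show "norm (N p) = 1"
      using N p unfolding unit_normal_field_def by blast
    show "((Q *v N p) \<bullet> v)\<^sup>2 = (N p \<bullet> v)\<^sup>2" if Q: "rotation_matrix Q" "Q *v u = u" for Q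
    proof -
      let ?b = "a - Q *v a"
      have "(\<lambda>x. a + Q *v (x - a)) = (\<lambda>x. ?b + Q *v x)"
        by (auto simp: matrix_vector_mult_diff_distrib)
      then have "(\<lambda>x. ?b + Q *v x) \<in> rotations_about a u"
        using Q unfolding rotations_about_def by (metis (mono_tags, lifting) mem_Collect_eq)
      then have S: "(\<lambda>x. ?b + Q *v x) ` \<Sigma> = \<Sigma>"
        by (rule inv)
      then have "?b + Q *v p \<in> \<Sigma>"
        using p by blast
      then have "N (?b + Q *v p) \<bullet> v = N p \<bullet> v"
        using speed p gauss_curvature_rigid_motion[OF Q(1) S, of p] by metis
      then show ?thesis
        using unit_normal_rigid_motion[OF Q(1) S reg N p, of v] by metis
    qed
  qed
  have "planar \<Sigma>"
  proof (rule planar_if_tangent_planes_orthogonal[OF \<open>connected \<Sigma>\<close> reg u])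
    fix p w assume p: "p \<in> \<Sigma>" and w: "w \<in> tangent_plane \<Sigma> p"
    have Np: "norm (N p) = 1" "N p \<bullet> w = 0"
      using N p w unfolding unit_normal_field_def by auto
    then obtain c where "N p = c *\<^sub>R u"
      using axial[OF p] u by (auto simp: cross_eq_0 collinear_lemma)
    with Np show "u \<bullet> w = 0"
      by auto
  qed
  with \<open>\<not> planar \<Sigma>\<close> show False
    by blast
qed

end
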